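(* Let $Q$ be a finite quandle, $q\in Q$, let $T$ be an oriented 4-tangle and $K$ a classical long knot. Suppose that $T$ embeds into $K$, i.e. there are a diagram $D_T$ of $T$ and a long knot diagram $D$ of $K$ such that $D_T$ is a part of $D$ (with matching orientations). Let $\zeta_{D_T}\in Col^q_Q(D_T)$ be any boundary-monochromatic coloring with boundary color $q$, let $\zeta\in Col(D,Q,q)$ be its trivial extension to $D$, and let $\phi^1_\zeta,\phi^2_\zeta$ be the two longitude parts obtained by travelling along the two components of $D_T$. Then either $\phi_{\zeta}^1\cdot \phi_{\zeta}^2$ or $\phi_{\zeta}^2\cdot \phi_{\zeta}^1$ (viewed as an automorphism of $Q$) belongs to $\Phi_{Q}^q(K)$.
   Context: **Quandles.** A quandle is a set $Q$ with two binary operations $\ast,\bar\ast$ such that for all $x,y,z\in Q$: $x\ast x=x$; $(x\ast y)\,\bar\ast\, y=x=(x\,\bar\ast\, y)\ast y$; $(x\ast y)\ast z=(x\ast z)\ast(y\ast z)$. The symbol $\ast^{\epsilon}$ denotes one of $\ast,\bar\ast$, and $\ast^{-\epsilon}$ denotes the opposite one. Products without parentheses are left-associated: $a\ast^{\epsilon_1}b\ast^{\epsilon_2}c=(a\ast^{\epsilon_1}b)\ast^{\epsilon_2}c$. For each $y\in Q$ the maps $x\mapsto x\ast y$ and $x\mapsto x\,\bar\ast\, y$ are automorphisms of $Q$. **Long knots.** A long knot diagram is a smooth immersion $f\colon\mathbb{R}\to\mathbb{R}^2$ with crossing information at each double point and $f(x)=(x,0)$ for $|x|$ large, oriented from left to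 right. A long knot is represented by such a diagram up to Reidemeister moves. **Colorings.** The normal of an arc of an oriented diagram is chosen so that (tangent, normal) matches the orientation of the plane. A quandle coloring of a diagram by $Q$ is a map $C$ from its set of arcs to $Q$ such that at each crossing with over-arc $r$, if $r_1$ is the under-arc such that the normal of $r$ points away from it and $r_2$ is the other under-arc, then $C(r_2)=C(r_1)\ast C(r)$. For a long knot diagram $D$, $Col(D,Q,q)$ is the set of all colorings of $D$ by $Q$ in which the initial arc has color $q$. **Colored quandle longitudes.** Let $D$ be a diagram of a long knot $K$ with $n$ crossings. Travelling along $D$ from left to right, label its arcs consecutively $x_1,\dots,x_{n+1}$. Let $x_{o(i)}$ be the over-arc encountered between $x_i$ and $x_{i+1}$, and let $\ast^{\epsilon_i}=\ast$ if the normal of that over-arc points away from $x_i$, and $\ast^{\epsilon_i}=\bar\ast$ otherwise. For a coloring $\zeta$ of $D$, the colored quandle longitude is the automorphism $\phi_\zeta\colon Q\to Q$, $$\phi_\zeta(x)=x\ast^{-\epsilon_1}\zeta(x_1)\ast^{\epsilon_1}\zeta(x_{o(1)})\ast^{-\epsilon_2}\zeta(x_2)\ast^{\epsilon_2}\zeta(x_{o(2)})\cdots\ast^{-\epsilon_n}\zeta(x_n)\ast^{\epsilon_n}\zeta(x_{o(n)}).$$ The colored quandle longitude invariant is the family $\Phi_Q^q(K)=\{\phi_\zeta\mid\zeta\in Col(D,Q,q)\}$; it does not depend on the choice of the diagram $D$ of $K$. **List notation.** An automorphism of $Q$ of the form $x\mapsto x\ast^{\delta_1}y_1\ast^{\delta_2}y_2\cdots\ast^{\delta_k}y_k$,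 with $y_1,\dots,y_k\in Q$ and each $\ast^{\delta_i}\in\{\ast,\bar\ast\}$, is also written as the list of the elements acting, in order, with an element $y$ written as $\overline{y}$ if it is preceded by $\bar\ast$ and as $y$ if it is preceded by $\ast$. A list acts on $x\in Q$ by applying its entries successively from left to right. The symbol $\cdot$ denotes concatenation of lists. **Tangles.** A 4-tangle consists of two disjoint arcs in the 3-ball; it is considered oriented, with two inputs and two outputs. A boundary-monochromatic coloring of a tangle diagram $D_T$ by $Q$ is a map from the arcs of $D_T$ to $Q$ satisfying the usual coloring condition at every crossing and such that all boundary points (i.e. the arcs containing them) receive the same color. $Col_Q^q(D_T)$ is the set of those whose boundary color is $q$. If $D_T$ is a part of a long knot diagram $D$, each $\zeta_{D_T}\in Col_Q^q(D_T)$ determines a coloring $\zeta\in Col(D,Q,q)$, its trivial extension, which gives color $q$ to all arcs outside $D_T$. **Longitude parts.** The two components of $D_T$ are numbered $1,2$. For $j\in\{1,2\}$, travel along component $j$ according to its orientation, passing consecutively along arcs $a_1,\dots,a_{m+1}$ of $D_T$; let $b_i$ be the over-arc (of either component) encountered between $a_i$ and $a_{i+1}$, and let $\ast^{\epsilon_i}=\ast$ if the normal of $b_i$ points away from $a_i$, $\ast^{\epsilon_i}=\bar\ast$ otherwise. Then $\phi^j_\zeta$ is the list corresponding to $x\mapsto x\ast^{-\epsilon_1}\zeta(a_1)\ast^{\epsilon_1}\zeta(b_1)\cdots\ast^{-\epsilon_m}\zeta(a_m)\ast^{\epsilon_m}\zeta(b_m)$. *)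

theory Defs
  imports "HOL-Analysis.Analysis"
begin

section \<open>Quandles\<close>

record 'a quandle_ops =
  elems :: "'a set"
  star :: "'a \<Rightarrow> 'a \<Rightarrow> 'a"
  bar_star :: "'a \<Rightarrow> 'a \<Rightarrow> 'a"

locale quandle =
  fixes Q :: "'a quandle_ops"
  assumes star_closed: "\<lbrakk>x \<in> elems Q; y \<in> elems Q\<rbrakk> \<Longrightarrow> star Q x y \<in> elems Q"
    and bar_star_closed: "\<lbrakk>x \<in> elems Q; y \<in> elems Q\<rbrakk> \<Longrightarrow> bar_star Q x y \<in> elems Q"
    and idem: "x \<in> elems Q \<Longrightarrow> star Q x x = x"
    and bar_star_star: "\<lbrakk>x \<in> elems Q; y \<in> elems Q\<rbrakk> \<Longrightarrow> bar_star Q (star Q x y) y = x"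
    and star_bar_star: "\<lbrakk>x \<in> elems Q; y \<in> elems Q\<rbrakk> \<Longrightarrow> star Q (bar_star Q x y) y = x"
    and self_distrib: "\<lbrakk>x \<in> elems Q; y \<in> elems Q; z \<in> elems Q\<rbrakk>
      \<Longrightarrow> star Q (star Q x y) z = star Q (star Q x z) (star Q y z)"

text \<open>An entry \<open>(True, y)\<close> of a list acts by \<open>star\<close>, an entry \<open>(False, y)\<close> (the barred
  element \<open>y\<close>) by \<open>bar_star\<close>. The resulting map is made extensional, so that two
  lists give the same automorphism iff they agree on \<open>elems Q\<close>.\<close>

definition signed_op :: "'a quandle_ops \<Rightarrow> bool \<Rightarrow> 'a \<Rightarrow> 'a \<Rightarrow> 'a" where
  "signed_op Q \<epsilon> = (if \<epsilon> then star Q else bar_star Q)"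

definition list_map :: "'a quandle_ops \<Rightarrow> (bool \<times> 'a) list \<Rightarrow> 'a \<Rightarrow> 'a" where
  "list_map Q L = (\<lambda>x\<in>elems Q. foldl (\<lambda>z (\<epsilon>, y). signed_op Q \<epsilon> z y) x L)"


section \<open>Diagrams\<close>

text \<open>A diagram is a curve in the plane, defined on a set of real parameters: the whole line for
  long knots, two disjoint compact intervals for 4-tangles. The crossing information is the set of
  those parameters at which the curve passes under.\<close>

record diagram =
  params :: "real set"
  curve :: "real \<Rightarrow> real \<times> real"
  underpasses :: "real set"

definition smooth_curve_on :: "real set \<Rightarrow> (real \<Rightarrow> real \<times> real) \<Rightarrow> bool" where
  "smooth_curve_on S f \<longleftrightarrow>
     (\<exists>F :: nat \<Rightarrow> real \<Rightarrow> real \<times> real. F 0 = f \<and>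
        (\<forall>k. \<forall>t\<in>S. (F k has_vector_derivative F (Suc k) t) (at t within S)))"

definition tangent :: "diagram \<Rightarrow> real \<Rightarrow> real \<times> real" where
  "tangent E t = vector_derivative (curve E) (at t within params E)"

text \<open>\<open>(v, normal v)\<close> is a positively oriented basis of the plane.\<close>

definition normal :: "real \<times> real \<Rightarrow> real \<times> real" where
  "normal v = (- snd v, fst v)"

definition double_points :: "diagram \<Rightarrow> (real \<times> real) set" where
  "double_points E =
     {(s, t). s \<in> params E \<and> t \<in> params E \<and> s \<noteq> t \<and> curve E s = curve E t}"

definition is_diagram :: "diagram \<Rightarrow> bool" where
  "is_diagram E \<longleftrightarrow>
     smooth_curve_on (params E) (curve E) \<and>
     (\<forall>t\<in>params E. tangent E t \<noteq> 0) \<and>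
     finite (double_points E) \<and>
     (\<forall>(s, t)\<in>double_points E. tangent E s \<bullet> normal (tangent E t) \<noteq> 0) \<and>
     (\<forall>r s t. (r, s) \<in> double_points E \<and> (r, t) \<in> double_points E \<longrightarrow> s = t) \<and>
     underpasses E \<subseteq> fst ` double_points E \<and>
     (\<forall>(s, t)\<in>double_points E. s \<in> underpasses E \<longleftrightarrow> t \<notin> underpasses E)"

definition long_knot_diagram :: "diagram \<Rightarrow> bool" where
  "long_knot_diagram D \<longleftrightarrow>
     is_diagram D \<and> params D = UNIV \<and> (\<exists>M. \<forall>x. \<bar>x\<bar> \<ge> M \<longrightarrow> curve D x = (x, 0))"

text \<open>Arcs are given by their sets of parameters.\<close>

type_synonym arc = "real set"

definition arcs :: "diagram \<Rightarrow> arc set" where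
  "arcs E = components (params E - underpasses E)"

definition arc_of :: "diagram \<Rightarrow> real \<Rightarrow> arc" where
  "arc_of E t = (THE A. A \<in> arcs E \<and> t \<in> A)"

definition initial_arc :: "diagram \<Rightarrow> arc" where
  "initial_arc D = (THE A. A \<in> arcs D \<and> (\<forall>\<^sub>F t in at_bot. t \<in> A))"

text \<open>A crossing is referred to by its underpass \<open>u\<close>: \<open>arc_before\<close> and \<open>arc_after\<close>
  are the two under-arcs, in the order of travel.\<close>

definition arc_before :: "diagram \<Rightarrow> real \<Rightarrow> arc" where
  "arc_before E u = (THE A. A \<in> arcs E \<and> (\<forall>\<^sub>F t in at_left u. t \<in> A))"

definition arc_after :: "diagram \<Rightarrow> real \<Rightarrow> arc" where
  "arc_after E u = (THE A. A \<in> arcs E \<and> (\<forall>\<^sub>F t in at_right u. t \<in> A))"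

definition overpass :: "diagram \<Rightarrow> real \<Rightarrow> real" where
  "overpass E u = (THE t. (u, t) \<in> double_points E)"

definition over_arc :: "diagram \<Rightarrow> real \<Rightarrow> arc" where
  "over_arc E u = arc_of E (overpass E u)"

text \<open>The normal of the over-arc points away from \<open>arc_before E u\<close> iff the under-strand
  crosses the over-strand in the direction of that normal.\<close>

definition crossing_sign :: "diagram \<Rightarrow> real \<Rightarrow> bool" where
  "crossing_sign E u \<longleftrightarrow> tangent E u \<bullet> normal (tangent E (overpass E u)) > 0"


section \<open>Colorings and longitudes\<close>

definition colorings :: "'a quandle_ops \<Rightarrow> diagram \<Rightarrow> (arc \<Rightarrow> 'a) set" where
  "colorings Q E =
     {C \<in> arcs E \<rightarrow>\<^sub>E elems Q. \<forall>u\<in>underpasses E.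
        if crossing_sign E u
        then C (arc_after E u) = star Q (C (arc_before E u)) (C (over_arc E u))
        else C (arc_before E u) = star Q (C (arc_after E u)) (C (over_arc E u))}"

definition Col :: "'a quandle_ops \<Rightarrow> 'a \<Rightarrow> diagram \<Rightarrow> (arc \<Rightarrow> 'a) set" where
  "Col Q q D = {C \<in> colorings Q D. C (initial_arc D) = q}"

text \<open>The list read off while travelling along the part of \<open>E\<close> parametrized by \<open>I\<close>.\<close>

definition longitude_list :: "diagram \<Rightarrow> (arc \<Rightarrow> 'a) \<Rightarrow> real set \<Rightarrow> (bool \<times> 'a) list" where
  "longitude_list E C I =
     concat (map (\<lambda>u. [(\<not> crossing_sign E u, C (arc_before E u)),
                       (crossing_sign E u, C (over_arc E u))])
       (sorted_list_of_set (underpasses E \<inter> I)))"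

definition colored_longitude :: "'a quandle_ops \<Rightarrow> diagram \<Rightarrow> (arc \<Rightarrow> 'a) \<Rightarrow> 'a \<Rightarrow> 'a" where
  "colored_longitude Q D \<zeta> = list_map Q (longitude_list D \<zeta> UNIV)"

text \<open>The value of the invariant on the long knot represented by the diagram \<open>D\<close>.\<close>

definition colored_longitude_family :: "'a quandle_ops \<Rightarrow> 'a \<Rightarrow> diagram \<Rightarrow> ('a \<Rightarrow> 'a) set" where
  "colored_longitude_family Q q D = {colored_longitude Q D \<zeta> | \<zeta>. \<zeta> \<in> Col Q q D}"


section \<open>Tangles\<close>

text \<open>A diagram, in the closed disc \<open>\<Delta>\<close>, of a 4-tangle with components parametrized by the
  intervals \<open>I\<close> and \<open>J\<close>. The left endpoints of the intervals are the two inputs, the right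
  endpoints the two outputs.\<close>

definition tangle_diagram :: "(real \<times> real) set \<Rightarrow> real set \<Rightarrow> real set \<Rightarrow> diagram \<Rightarrow> bool" where
  "tangle_diagram \<Delta> I J T \<longleftrightarrow>
     is_diagram T \<and>
     \<Delta> homeomorphic (cball 0 1 :: (real \<times> real) set) \<and>
     (\<exists>a b c d. a < b \<and> c < d \<and> I = {a..b} \<and> J = {c..d} \<and> I \<inter> J = {} \<and>
        params T = I \<union> J \<and>
        curve T ` params T \<subseteq> \<Delta> \<and>
        (\<forall>t\<in>params T. curve T t \<in> frontier \<Delta> \<longleftrightarrow> t \<in> {a, b, c, d}) \<and>
        inj_on (curve T) {a, b, c, d})"

text \<open>A diagram is considered up to reparametrization, so a part of \<open>D\<close> is taken with the
  parametrization it inherits from \<open>D\<close>.\<close>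

definition part_of :: "(real \<times> real) set \<Rightarrow> diagram \<Rightarrow> diagram \<Rightarrow> bool" where
  "part_of \<Delta> T D \<longleftrightarrow>
     params T = {t \<in> params D. curve D t \<in> \<Delta>} \<and>
     (\<forall>t\<in>params T. curve T t = curve D t) \<and>
     underpasses T = underpasses D \<inter> params T"

definition boundary_mono_colorings ::
    "'a quandle_ops \<Rightarrow> 'a \<Rightarrow> (real \<times> real) set \<Rightarrow> diagram \<Rightarrow> (arc \<Rightarrow> 'a) set" where
  "boundary_mono_colorings Q q \<Delta> T =
     {C \<in> colorings Q T. \<forall>t\<in>params T. curve T t \<in> frontier \<Delta> \<longrightarrow> C (arc_of T t) = q}"

text \<open>An arc of \<open>D\<close> may contain several arcs of \<open>T\<close>, if it leaves \<open>T\<close> and returns to it;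
  all of these contain boundary points and have the same color in a boundary-monochromatic
  coloring.\<close>

definition trivial_extension ::
    "diagram \<Rightarrow> diagram \<Rightarrow> 'a \<Rightarrow> (arc \<Rightarrow> 'a) \<Rightarrow> arc \<Rightarrow> 'a" where
  "trivial_extension D T q \<zeta>T =
     (\<lambda>A\<in>arcs D. if \<exists>B\<in>arcs T. B \<subseteq> A then \<zeta>T (SOME B. B \<in> arcs T \<and> B \<subseteq> A) else q)"

text \<open>The color that a coloring \<open>\<zeta>\<close> of \<open>D\<close> gives to an arc \<open>B\<close> of a part of \<open>D\<close>.\<close>

definition color_in :: "diagram \<Rightarrow> (arc \<Rightarrow> 'a) \<Rightarrow> arc \<Rightarrow> 'a" where
  "color_in D \<zeta> B = \<zeta> (THE A. A \<in> arcs D \<and> B \<subseteq> A)"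

definition longitude_part ::
    "diagram \<Rightarrow> diagram \<Rightarrow> (arc \<Rightarrow> 'a) \<Rightarrow> real set \<Rightarrow> (bool \<times> 'a) list" where
  "longitude_part D T \<zeta> I = longitude_list T (color_in D \<zeta>) I"

end

theory Submission
  imports Defs
begin

text \<open>
  The reason is that the trivial extension \<open>\<zeta>\<close> of the tangle coloring is itself a coloring of
  the long knot diagram, and the longitude of this coloring is the product of the two longitude
  parts, in the order in which the long knot runs through the two components.

  The extension is a coloring (\<open>extension_in_Col\<close>). At a crossing inside the disc \<open>\<zeta>\<close> gives the
  three arcs the same colors as the tangle coloring (\<open>extension_crossing_inside\<close>). The point to
  check here is that \<open>\<zeta>\<close> is well defined: an arc of the long knot that contains more than one arc
  of the tangle leaves the disc between them, so each of them ends on the boundary of the disc and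
  has color \<open>q\<close> (\<open>proper_subarc_color\<close>). At a crossing outside the disc all three arcs leave the
  disc, so for the same reason they all have color \<open>q\<close> (\<open>extension_crossing_outside\<close>), and the
  coloring condition is \<open>q * q = q\<close>. No crossing lies on the boundary circle, because the four
  endpoints of the tangle are distinct.

  The longitude of \<open>\<zeta>\<close> is the composition of the contributions of all underpasses, in the order of
  travel. An underpass outside the disc contributes the action of \<open>q\<close> in one direction followed by
  its action in the other one, which is the identity. The remaining underpasses are those of the
  component that is traversed first, followed by those of the other component
  (\<open>colored_longitude_extension\<close>). Which component comes first is not determined by the tangle,
  hence the alternative in the theorem.
\<close>


section \<open>Arcs at a filter\<close>

text \<open>The arc before an underpass, the arc after it, the over-arc and the initial arc are all given
  by the same description, with respect to the filters \<open>at_left u\<close>, \<open>at_right u\<close>,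
  \<open>principal {t}\<close> and \<open>at_bot\<close>. Treating them as instances of one notion lets each
  fact about the colors of arcs be proved once.\<close>

definition arc_at :: "diagram \<Rightarrow> real filter \<Rightarrow> arc" where
  "arc_at E F = (THE A. A \<in> arcs E \<and> (\<forall>\<^sub>F t in F. t \<in> A))"

text \<open>The condition under which \<open>arc_at\<close> is meaningful. It asks for a connected set rather than for
  an arc, so that it passes from a tangle to the long knot, whose arcs are larger
  (\<open>on_one_arc_T_imp_D\<close>).\<close>

definition on_one_arc :: "diagram \<Rightarrow> real filter \<Rightarrow> bool" where
  "on_one_arc E F \<longleftrightarrow> F \<noteq> bot \<and>
     (\<exists>S. connected S \<and> S \<subseteq> params E - underpasses E \<and> (\<forall>\<^sub>F t in F. t \<in> S))"

lemma arc_before_eq_arc_at: "arc_before E u = arc_at E (at_left u)"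
  by (simp add: arc_before_def arc_at_def)

lemma arc_after_eq_arc_at: "arc_after E u = arc_at E (at_right u)"
  by (simp add: arc_after_def arc_at_def)

lemma arc_of_eq_arc_at: "arc_of E t = arc_at E (principal {t})"
  by (simp add: arc_of_def arc_at_def eventually_principal)

lemma initial_arc_eq_arc_at: "initial_arc E = arc_at E at_bot"
  by (simp add: initial_arc_def arc_at_def)

lemma arcs_eqI: "\<lbrakk>A \<in> arcs E; B \<in> arcs E; t \<in> A; t \<in> B\<rbrakk> \<Longrightarrow> A = B"
  unfolding arcs_def using components_nonoverlap by blast

lemma connected_subset_arc:
  assumes "connected S" "S \<subseteq> params E - underpasses E" "t \<in> S"
  obtains A where "A \<in> arcs E" "S \<subseteq> A"
  using exists_component_superset[of S "params E - underpasses E"] assms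
  unfolding arcs_def by auto

lemma arc_subset: "A \<in> arcs E \<Longrightarrow> A \<subseteq> params E - underpasses E"
  and arc_connected: "A \<in> arcs E \<Longrightarrow> connected A"
  and arc_nonempty: "A \<in> arcs E \<Longrightarrow> A \<noteq> {}"
  unfolding arcs_def
  using in_components_subset in_components_connected in_components_nonempty by blast+

lemma connected_subset_arc_meeting:
  assumes "A \<in> arcs E" "connected S" "S \<subseteq> params E - underpasses E" "t \<in> S" "t \<in> A"
  shows "S \<subseteq> A"
  by (metis arcs_eqI assms connected_subset_arc in_mono)

lemma arc_at_eqI:
  assumes "F \<noteq> bot" "A \<in> arcs E" "\<forall>\<^sub>F t in F. t \<in> A"
  shows "arc_at E F = A"
  unfolding arc_at_def
proof (rule the_equality)
  fix B assume B: "B \<in> arcs E \<and> (\<forall>\<^sub>F t in F. t \<in> B)"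
  then have "\<forall>\<^sub>F t in F. t \<in> A \<and> t \<in> B"
    using assms(3) eventually_conj by blast
  then obtain t where "t \<in> A" "t \<in> B"
    using assms(1) eventually_happens' by blast
  then show "B = A"
    using arcs_eqI B assms(2) by blast
qed (use assms in auto)

lemma arc_at:
  assumes "on_one_arc E F"
  shows arc_at_in_arcs: "arc_at E F \<in> arcs E"
    and eventually_arc_at: "\<forall>\<^sub>F t in F. t \<in> arc_at E F"
proof -
  obtain S where S: "F \<noteq> bot" "connected S" "S \<subseteq> params E - underpasses E" "\<forall>\<^sub>F t in F. t \<in> S"
    using assms unfolding on_one_arc_def by blast
  obtain t where "t \<in> S"
    using S eventually_happens' by blast
  then obtain A where A: "A \<in> arcs E" "S \<subseteq> A"
    using S connected_subset_arc by blast
  have ev: "\<forall>\<^sub>F t in F. t \<in> A"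
    using S(4) by (rule eventually_mono) (use A in auto)
  then have "arc_at E F = A"
    using S A arc_at_eqI by blast
  then show "arc_at E F \<in> arcs E" "\<forall>\<^sub>F t in F. t \<in> arc_at E F"
    using A ev by auto
qed

lemma on_one_arc_principal:
  "t \<in> params E \<Longrightarrow> t \<notin> underpasses E \<Longrightarrow> on_one_arc E (principal {t})"
  unfolding on_one_arc_def
  by (auto simp: eventually_principal principal_eq_bot_iff intro!: exI[of _ "{t}"])

text \<open>Only finitely many parameters are underpasses, so a small punctured interval around \<open>u\<close>
  contains none of them.\<close>

lemma on_one_arc_at_sides:
  assumes "finite (underpasses E)" "u \<in> interior (params E)"
  shows on_one_arc_at_left: "on_one_arc E (at_left u)"
    and on_one_arc_at_right: "on_one_arc E (at_right u)"
proof -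
  have "open (interior (params E) - (underpasses E - {u}))"
    using assms by (intro open_Diff finite_imp_closed) auto
  then obtain e where e: "e > 0" "ball u e \<subseteq> interior (params E) - (underpasses E - {u})"
    using assms(2) by (meson Diff_iff openE singletonI)
  have sub: "{u-e<..<u} \<subseteq> params E - underpasses E" "{u<..<u+e} \<subseteq> params E - underpasses E"
    using e(2) interior_subset[of "params E"] by (force simp: ball_eq_greaterThanLessThan)+
  have "\<forall>\<^sub>F t in at_left u. t \<in> {u-e<..<u}" "\<forall>\<^sub>F t in at_right u. t \<in> {u<..<u+e}"
    using e(1) eventually_at_left_real[of "u-e" u] eventually_at_right_real[of u "u+e"] by auto
  then show "on_one_arc E (at_left u)" "on_one_arc E (at_right u)"
    unfolding on_one_arc_def using sub connected_Ioo trivial_limit_at_left_real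
      trivial_limit_at_right_real by blast+
qed


section \<open>Crossings\<close>

lemma finite_underpasses: "is_diagram E \<Longrightarrow> finite (underpasses E)"
  unfolding is_diagram_def using finite_subset by blast

lemma overpass_eqI:
  assumes "is_diagram E" "(u, t) \<in> double_points E"
  shows "overpass E u = t"
  using assms unfolding overpass_def is_diagram_def by (intro the_equality) blast+

lemma double_point_overpass:
  assumes "is_diagram E" "u \<in> underpasses E"
  shows "(u, overpass E u) \<in> double_points E"
proof -
  have "underpasses E \<subseteq> fst ` double_points E"
    using assms(1) unfolding is_diagram_def by (elim conjE)
  then obtain t where "(u, t) \<in> double_points E"
    using assms(2) by force
  then show ?thesis
    using overpass_eqI assms by metis
qed

lemma on_one_arc_overpass:
  assumes "is_diagram E" "u \<in> underpasses E"
  shows "on_one_arc E (principal {overpass E u})"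
proof (rule on_one_arc_principal)
  have dp: "(u, overpass E u) \<in> double_points E"
    using assms by (rule double_point_overpass)
  then show "overpass E u \<in> params E"
    by (simp add: double_points_def)
  have "\<forall>(s, t)\<in>double_points E. s \<in> underpasses E \<longleftrightarrow> t \<notin> underpasses E"
    using assms(1) unfolding is_diagram_def by (elim conjE)
  from bspec[OF this dp] show "overpass E u \<notin> underpasses E"
    using assms(2) by simp
qed

text \<open>Tangents are derivatives within the parameter set, so a tangle and the long knot that contains it
  need not have the same tangent at an endpoint of the tangle; at an interior parameter the
  derivative is a local notion.\<close>

lemma tangent_eq:
  assumes "is_diagram E" "t \<in> interior (params E)" "params E \<subseteq> params E'"
    and "\<And>s. s \<in> params E \<Longrightarrow> curve E s = curve E' s"
  shows "tangent E t = tangent E' t"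
proof -
  have t: "t \<in> params E" "t \<in> interior (params E')"
    using assms(2,3) interior_subset interior_mono by blast+
  obtain v where "(curve E has_vector_derivative v) (at t within params E)"
    using assms(1) t unfolding is_diagram_def smooth_curve_on_def by metis
  then have v: "(curve E has_vector_derivative v) (at t)"
    using at_within_interior[OF assms(2)] by simp
  then have v': "(curve E' has_vector_derivative v) (at t)"
    by (rule has_vector_derivative_transform_within_open[where S = "interior (params E)"])
      (use assms interior_subset in auto)
  show ?thesis
    unfolding tangent_def at_within_interior[OF assms(2)] at_within_interior[OF t(2)]
    using v v' by (simp add: vector_derivative_at)
qed


section \<open>Lists acting on a quandle\<close>

abbreviation acts :: "'a quandle_ops \<Rightarrow> 'a \<Rightarrow> (bool \<times> 'a) list \<Rightarrow> 'a" where
  "acts Q \<equiv> foldl (\<lambda>z (\<epsilon>, y). signed_op Q \<epsilon> z y)"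

context quandle
begin

lemma signed_op_closed: "\<lbrakk>x \<in> elems Q; y \<in> elems Q\<rbrakk> \<Longrightarrow> signed_op Q \<epsilon> x y \<in> elems Q"
  by (simp add: signed_op_def star_closed bar_star_closed)

lemma acts_closed: "\<lbrakk>x \<in> elems Q; snd ` set L \<subseteq> elems Q\<rbrakk> \<Longrightarrow> acts Q x L \<in> elems Q"
  by (induction L arbitrary: x) (auto simp: signed_op_closed)

text \<open>The contribution of a crossing to a longitude when its under- and over-arc have the same
  color \<open>y\<close>; this is how crossings outside a tangle disappear.\<close>

lemma acts_cancel:
  "\<lbrakk>x \<in> elems Q; y \<in> elems Q\<rbrakk> \<Longrightarrow> acts Q x [(\<not> \<epsilon>, y), (\<epsilon>, y)] = x"
  by (simp add: signed_op_def star_bar_star bar_star_star)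

lemma acts_concat_filter:
  assumes "x \<in> elems Q"
    and "\<And>u. u \<in> set us \<Longrightarrow> snd ` set (f u) \<subseteq> elems Q"
    and "\<And>u z. \<lbrakk>u \<in> set us; \<not> P u; z \<in> elems Q\<rbrakk> \<Longrightarrow> acts Q z (f u) = z"
  shows "acts Q x (concat (map f us)) = acts Q x (concat (map f (filter P us)))"
  using assms
proof (induction us arbitrary: x)
  case (Cons u us)
  have "acts Q x (f u) \<in> elems Q"
    using Cons.prems by (intro acts_closed) auto
  then have "acts Q (acts Q x (f u)) (concat (map f us))
      = acts Q (acts Q x (f u)) (concat (map f (filter P us)))"
    using Cons.prems by (intro Cons.IH) auto
  then show ?case
    using Cons.prems by auto
qed simp

end

text \<open>For \<open>U\<close> the underpasses of a long knot and \<open>I\<close>, \<open>J\<close> the components of a tangle: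
  one of them is traversed completely before the other one is entered.\<close>

lemma filter_sorted_list_of_set_split:
  fixes U :: "'b::linorder set"
  assumes "finite U" and "\<And>s t. \<lbrakk>s \<in> I; t \<in> J\<rbrakk> \<Longrightarrow> s < t"
  shows "filter (\<lambda>u. u \<in> I \<union> J) (sorted_list_of_set U)
       = sorted_list_of_set (U \<inter> I) @ sorted_list_of_set (U \<inter> J)"
  using assms
  by (intro sorted_distinct_set_unique)
    (auto simp: sorted_append sorted_wrt_filter less_imp_le dest: less_imp_neq)


section \<open>The trivial extension\<close>

text \<open>The two components enter symmetrically, so that the locale can be interpreted a second time
  with their roles exchanged.\<close>

locale embedded_tangle = quandle Q for Q :: "'a quandle_ops" +
  fixes q :: 'a and D T :: diagram and \<Delta> :: "(real \<times> real) set"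
    and a b c d :: real and \<zeta>T :: "arc \<Rightarrow> 'a"
  assumes q: "q \<in> elems Q"
    and D: "long_knot_diagram D"
    and T: "is_diagram T"
    and params_T: "params T = {a..b} \<union> {c..d}"
    and frontier_iff: "\<And>t. t \<in> params T \<Longrightarrow> curve T t \<in> frontier \<Delta> \<longleftrightarrow> t \<in> {a, b, c, d}"
    and inj_endpoints: "inj_on (curve T) {a, b, c, d}"
    and part: "part_of \<Delta> T D"
    and \<zeta>T: "\<zeta>T \<in> boundary_mono_colorings Q q \<Delta> T"
begin

abbreviation \<zeta> :: "arc \<Rightarrow> 'a" where
  "\<zeta> \<equiv> trivial_extension D T q \<zeta>T"

lemma diagram_D: "is_diagram D" and params_D: "params D = UNIV"
  using D unfolding long_knot_diagram_def by auto

lemma params_T_iff: "t \<in> params T \<longleftrightarrow> curve D t \<in> \<Delta>"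
  and curve_T: "t \<in> params T \<Longrightarrow> curve T t = curve D t"
  and underpasses_T: "underpasses T = underpasses D \<inter> params T"
  using part params_D unfolding part_of_def by auto

lemma double_points_T: "double_points T = double_points D \<inter> params T \<times> params T"
  unfolding double_points_def using curve_T params_D by auto

lemma double_point_params_T_iff:
  "(s, t) \<in> double_points D \<Longrightarrow> s \<in> params T \<longleftrightarrow> t \<in> params T"
  unfolding double_points_def by (auto simp: params_T_iff)

text \<open>A double point on the boundary of the disc would make two endpoints of the tangle coincide.\<close>

lemma double_point_interior:
  assumes "(s, t) \<in> double_points T"
  shows "s \<in> interior (params T)"
proof -
  have st: "s \<in> params T" "t \<in> params T" "s \<noteq> t" "curve T s = curve T t"
    using assms by (auto simp: double_points_def)
  have "s \<notin> {a, b, c, d}"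
  proof
    assume s: "s \<in> {a, b, c, d}"
    then have "t \<in> {a, b, c, d}"
      using frontier_iff st by metis
    then show False
      using inj_endpoints s st by (meson inj_onD)
  qed
  then have "s \<in> {a<..<b} \<union> {c<..<d}"
    using st(1) params_T by auto
  moreover have "{a<..<b} \<union> {c<..<d} \<subseteq> interior (params T)"
    by (intro interior_maximal) (auto simp: params_T)
  ultimately show ?thesis by blast
qed

lemma overpass_T:
  assumes "u \<in> underpasses T"
  shows "overpass T u = overpass D u"
    and "u \<in> interior (params T)" and "overpass T u \<in> interior (params T)"
proof -
  have dp: "(u, overpass T u) \<in> double_points T"
    using T assms by (rule double_point_overpass)
  then show "overpass T u = overpass D u"
    using overpass_eqI[OF diagram_D] double_points_T by fastforce
  have "(overpass T u, u) \<in> double_points T"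
    using dp by (auto simp: double_points_def)
  then show "u \<in> interior (params T)" "overpass T u \<in> interior (params T)"
    using dp double_point_interior by blast+
qed

lemma crossing_sign_T:
  assumes "u \<in> underpasses T"
  shows "crossing_sign T u = crossing_sign D u"
proof -
  have "tangent T t = tangent D t" if "t \<in> interior (params T)" for t
    using that T curve_T params_D by (intro tangent_eq) auto
  then show ?thesis
    using overpass_T[OF assms] by (simp add: crossing_sign_def)
qed

lemma on_one_arc_T_imp_D: "on_one_arc T F \<Longrightarrow> on_one_arc D F"
proof -
  assume "on_one_arc T F"
  moreover have "params T - underpasses T \<subseteq> params D - underpasses D"
    using params_D underpasses_T by auto
  ultimately show ?thesis
    unfolding on_one_arc_def by (meson subset_trans)
qed

lemma on_one_arc_crossing_T:
  assumes "u \<in> underpasses T"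
  shows "on_one_arc T (at_left u)" "on_one_arc T (at_right u)"
    "on_one_arc T (principal {overpass T u})"
  using on_one_arc_at_sides[OF finite_underpasses[OF T] overpass_T(2)[OF assms]]
    on_one_arc_overpass[OF T assms] by auto

lemma on_one_arc_crossing_D:
  assumes "u \<in> underpasses D"
  shows "on_one_arc D (at_left u)" "on_one_arc D (at_right u)"
    "on_one_arc D (principal {overpass D u})"
  using on_one_arc_at_sides[OF finite_underpasses[OF diagram_D], of u]
    on_one_arc_overpass[OF diagram_D assms] by (auto simp: params_D)

lemma endpoint_color:
  assumes "B \<in> arcs T" "t \<in> B" "t \<in> {a, b, c, d}"
  shows "\<zeta>T B = q"
proof -
  have t: "t \<in> params T"
    using assms arc_subset by blast
  have "arc_of T t = B"
    unfolding arc_of_eq_arc_at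
    using assms by (intro arc_at_eqI) (auto simp: eventually_principal principal_eq_bot_iff)
  then show ?thesis
    using \<zeta>T t frontier_iff assms(3) unfolding boundary_mono_colorings_def by auto
qed

text \<open>If an arc of the long knot is larger than an arc \<open>B\<close> of the tangle inside it, then
  it continues beyond \<open>B\<close>. There is no underpass on the way, so \<open>B\<close> can
  only have ended at an endpoint of the tangle.\<close>

lemma proper_subarc_color:
  assumes A: "A \<in> arcs D" and B: "B \<in> arcs T" "B \<subseteq> A" and "\<not> A \<subseteq> B"
  shows "\<zeta>T B = q"
proof -
  obtain x y where x: "x \<in> B" and y: "y \<in> A" "y \<notin> B"
    using assms arc_nonempty by blast
  have x_params: "x \<in> params T"
    using x B(1) arc_subset by blast
  \<comment> \<open>Inside one of the two intervals, every parameter of \<open>A\<close> is connected to \<open>x\<close> within \<open>T\<close>.\<close>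
  have reach: "t \<in> B" if s: "s = a \<and> e = b \<or> s = c \<and> e = d" and "x \<in> {s..e}" "t \<in> {s..e}" "t \<in> A" for s e t
  proof -
    have seg: "closed_segment x t \<subseteq> A"
      using A x B(2) that(4) arc_connected is_interval_connected_1 is_interval_convex_1
      by (metis closed_segment_subset in_mono)
    have "closed_segment x t \<subseteq> {s..e}"
      using that by (intro closed_segment_subset) auto
    then have "closed_segment x t \<subseteq> params T"
      using s params_T by blast
    then have "closed_segment x t \<subseteq> params T - underpasses T"
      using seg arc_subset[OF A] underpasses_T by blast
    then have "closed_segment x t \<subseteq> B"
      using B x connected_subset_arc_meeting[of B T "closed_segment x t" x] by auto
    then show ?thesis by auto
  qed
  obtain s e where s: "s = a \<and> e = b \<or> s = c \<and> e = d" and xs: "x \<in> {s..e}"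
    using x_params params_T by blast
  have between: "t \<in> A" if "t \<in> closed_segment x y" for t
    using A x B(2) y that arc_connected is_interval_connected_1 is_interval_convex_1
    by (metis closed_segment_subset in_mono)
  \<comment> \<open>The arc \<open>A\<close> leaves the interval of \<open>x\<close> towards \<open>y\<close>, hence through one of its ends.\<close>
  have "y \<notin> {s..e}"
    using reach[OF s xs] y by blast
  then have "y < s \<or> e < y" by auto
  then have "s \<in> B \<or> e \<in> B"
  proof
    assume "y < s"
    then show ?thesis
      using reach[OF s xs, of s] between[of s] xs by (auto simp: closed_segment_eq_real_ivl)
  next
    assume "e < y"
    then show ?thesis
      using reach[OF s xs, of e] between[of e] xs by (auto simp: closed_segment_eq_real_ivl)
  qed
  then show ?thesis
    using endpoint_color[OF B(1)] s by blast
qed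

text \<open>The choice made in the definition of the trivial extension is immaterial: of two different
  tangle arcs inside \<open>A\<close> neither can be all of \<open>A\<close>, so both have color \<open>q\<close>.\<close>

lemma extension_on_subarc:
  assumes A: "A \<in> arcs D" and B: "B \<in> arcs T" "B \<subseteq> A"
  shows "\<zeta> A = \<zeta>T B"
proof -
  define B' where "B' = (SOME B. B \<in> arcs T \<and> B \<subseteq> A)"
  have B': "B' \<in> arcs T" "B' \<subseteq> A"
    using someI[of "\<lambda>B. B \<in> arcs T \<and> B \<subseteq> A" B] B unfolding B'_def by auto
  have "\<zeta>T B' = \<zeta>T B"
  proof (cases "B' = B")
    case False
    then have "B \<inter> B' = {}"
      using arcs_eqI B B' by blast
    then have "\<not> A \<subseteq> B" "\<not> A \<subseteq> B'"
      using B B' arc_nonempty by blast+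
    then show ?thesis
      using proper_subarc_color A B B' by simp
  qed simp
  moreover have "\<zeta> A = \<zeta>T B'"
    unfolding trivial_extension_def B'_def using A B by auto
  ultimately show ?thesis by simp
qed

lemma extension_leaving_tangle:
  assumes A: "A \<in> arcs D" and "\<not> A \<subseteq> params T"
  shows "\<zeta> A = q"
proof (cases "\<exists>B\<in>arcs T. B \<subseteq> A")
  case True
  then obtain B where B: "B \<in> arcs T" "B \<subseteq> A" by blast
  then have "\<not> A \<subseteq> B"
    using assms(2) arc_subset by blast
  then show ?thesis
    using extension_on_subarc proper_subarc_color A B by simp
qed (use A in \<open>simp add: trivial_extension_def\<close>)

lemma extension_inside:
  assumes "on_one_arc T F"
  shows "\<zeta> (arc_at D F) = \<zeta>T (arc_at T F)"
    and "color_in D \<zeta> (arc_at T F) = \<zeta> (arc_at D F)"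
proof -
  have B: "arc_at T F \<in> arcs T" "\<forall>\<^sub>F t in F. t \<in> arc_at T F" and F: "F \<noteq> bot"
    using assms arc_at by (auto simp: on_one_arc_def)
  have "arc_at T F \<subseteq> params D - underpasses D"
    using arc_subset[OF B(1)] underpasses_T params_D by blast
  then obtain A where A: "A \<in> arcs D" "arc_at T F \<subseteq> A"
    using B(1) arc_connected arc_nonempty connected_subset_arc by (metis ex_in_conv)
  have "\<forall>\<^sub>F t in F. t \<in> A"
    using B(2) by (rule eventually_mono) (use A in auto)
  then have A_eq: "arc_at D F = A"
    using F A arc_at_eqI by blast
  then show "\<zeta> (arc_at D F) = \<zeta>T (arc_at T F)"
    using extension_on_subarc A B by simp
  have "(THE A. A \<in> arcs D \<and> arc_at T F \<subseteq> A) = A"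
    using A arcs_eqI arc_nonempty[OF B(1)] by (intro the_equality) blast+
  then show "color_in D \<zeta> (arc_at T F) = \<zeta> (arc_at D F)"
    by (simp add: color_in_def A_eq)
qed

lemma extension_outside:
  assumes "on_one_arc D F" "\<forall>\<^sub>F t in F. t \<notin> params T"
  shows "\<zeta> (arc_at D F) = q"
proof -
  have "\<forall>\<^sub>F t in F. t \<in> arc_at D F \<and> t \<notin> params T"
    using eventually_arc_at[OF assms(1)] assms(2) eventually_conj by blast
  then obtain t where "t \<in> arc_at D F" "t \<notin> params T"
    using assms(1) eventually_happens' unfolding on_one_arc_def by blast
  then show ?thesis
    using extension_leaving_tangle arc_at_in_arcs[OF assms(1)] by blast
qed

text \<open>Both strands of such a crossing are outside the closed disc near the crossing, so the arcs that
  meet there leave the tangle.\<close>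

lemma extension_crossing_outside:
  assumes u: "u \<in> underpasses D" "u \<notin> params T"
  shows "\<zeta> (arc_before D u) = q" "\<zeta> (arc_after D u) = q" "\<zeta> (over_arc D u) = q"
proof -
  have "overpass D u \<notin> params T"
    using double_point_overpass[OF diagram_D u(1)] double_point_params_T_iff u(2) by blast
  moreover have "\<forall>\<^sub>F t in at u. t \<notin> params T"
    using u(2) eventually_at_topological[of "\<lambda>t. t \<notin> params T" u UNIV]
    by (metis ComplI ComplD open_Compl closed_Un closed_atLeastAtMost params_T)
  ultimately show "\<zeta> (arc_before D u) = q" "\<zeta> (arc_after D u) = q" "\<zeta> (over_arc D u) = q"
    unfolding arc_before_eq_arc_at arc_after_eq_arc_at over_arc_def arc_of_eq_arc_at
    using on_one_arc_crossing_D[OF u(1)]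
    by (auto intro!: extension_outside simp: eventually_principal eventually_at_split)
qed

lemma extension_crossing_inside:
  assumes u: "u \<in> underpasses T"
  shows "\<zeta> (arc_before D u) = \<zeta>T (arc_before T u)" "\<zeta> (arc_after D u) = \<zeta>T (arc_after T u)"
    "\<zeta> (over_arc D u) = \<zeta>T (over_arc T u)"
    "color_in D \<zeta> (arc_before T u) = \<zeta> (arc_before D u)"
    "color_in D \<zeta> (over_arc T u) = \<zeta> (over_arc D u)"
  unfolding arc_before_eq_arc_at arc_after_eq_arc_at over_arc_def arc_of_eq_arc_at
  using on_one_arc_crossing_T[OF u] extension_inside overpass_T(1)[OF u] by auto

lemma extension_in_Col: "\<zeta> \<in> Col Q q D"
proof -
  have T_col: "\<zeta>T \<in> colorings Q T"
    using \<zeta>T by (simp add: boundary_mono_colorings_def)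
  have "\<zeta> \<in> arcs D \<rightarrow>\<^sub>E elems Q"
  proof (rule PiE_I)
    fix A assume A: "A \<in> arcs D"
    show "\<zeta> A \<in> elems Q"
    proof (cases "\<exists>B\<in>arcs T. B \<subseteq> A")
      case True
      then show ?thesis
        using extension_on_subarc A T_col unfolding colorings_def by fastforce
    qed (use A q in \<open>simp add: trivial_extension_def\<close>)
  qed (simp add: trivial_extension_def)
  moreover have "if crossing_sign D u
      then \<zeta> (arc_after D u) = star Q (\<zeta> (arc_before D u)) (\<zeta> (over_arc D u))
      else \<zeta> (arc_before D u) = star Q (\<zeta> (arc_after D u)) (\<zeta> (over_arc D u))"
    if u: "u \<in> underpasses D" for u
  proof (cases "u \<in> params T")
    case True
    then have "u \<in> underpasses T"
      using u underpasses_T by blast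
    then show ?thesis
      using T_col extension_crossing_inside(1-3) crossing_sign_T unfolding colorings_def by auto
  next
    case False
    then show ?thesis
      using extension_crossing_outside u idem q by simp
  qed
  moreover have "\<zeta> (initial_arc D) = q"
  proof -
    have "eventually (\<lambda>t. t \<notin> params T) at_bot"
      using eventually_gt_at_bot[of "min a c"] by (rule eventually_mono) (auto simp: params_T)
    moreover have "on_one_arc D at_bot"
    proof -
      \<comment> \<open>Left of its first underpass the long knot is a single arc.\<close>
      obtain m where m: "\<And>u. u \<in> underpasses D \<Longrightarrow> m \<le> u"
        using finite_imp_bounded[OF finite_underpasses[OF diagram_D]] bounded_imp_bdd_below
        by (meson bdd_below.E)
      have "{..<m} \<subseteq> params D - underpasses D"
        using m params_D by force
      then show ?thesis
        unfolding on_one_arc_def using eventually_gt_at_bot[of m]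
        by (auto intro!: exI[of _ "{..<m}"])
    qed
    ultimately show ?thesis
      unfolding initial_arc_eq_arc_at by (intro extension_outside)
  qed
  ultimately show ?thesis
    unfolding Col_def colorings_def by blast
qed


section \<open>The longitude of the trivial extension\<close>

text \<open>Under- and over-arcs of the tangle have the colors of the long knot arcs that contain them, and
  the signs of the crossings agree.\<close>

lemma longitude_part_eq:
  assumes "I \<subseteq> params T"
  shows "longitude_part D T \<zeta> I = longitude_list D \<zeta> I"
proof -
  have eq: "underpasses T \<inter> I = underpasses D \<inter> I" and fin: "finite (underpasses T \<inter> I)"
    using underpasses_T assms finite_underpasses[OF T] by auto
  show ?thesis
    unfolding longitude_part_def longitude_list_def eq[symmetric]
    by (intro arg_cong[where f = concat] map_cong refl)
      (use fin in \<open>simp add: crossing_sign_T extension_crossing_inside(4,5)\<close>)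
qed

text \<open>Crossings outside the tangle act trivially and can be dropped from the longitude; sorting the
  remaining ones puts those of the first component first.\<close>

lemma colored_longitude_extension:
  assumes "b < c"
  shows "list_map Q (longitude_part D T \<zeta> {a..b} @ longitude_part D T \<zeta> {c..d})
    = colored_longitude Q D \<zeta>"
proof -
  let ?f = "\<lambda>u. [(\<not> crossing_sign D u, \<zeta> (arc_before D u)), (crossing_sign D u, \<zeta> (over_arc D u))]"
  let ?us = "sorted_list_of_set (underpasses D)"
  have fin: "finite (underpasses D)"
    using diagram_D by (rule finite_underpasses)
  have filter: "filter (\<lambda>u. u \<in> params T) ?us
      = sorted_list_of_set (underpasses D \<inter> {a..b}) @ sorted_list_of_set (underpasses D \<inter> {c..d})"
    unfolding params_T using fin assms by (intro filter_sorted_list_of_set_split) auto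
  have "acts Q x (concat (map ?f ?us))
      = acts Q x (concat (map ?f (filter (\<lambda>u. u \<in> params T) ?us)))" if x: "x \<in> elems Q" for x
  proof (rule acts_concat_filter[OF x])
    fix u assume "u \<in> set ?us"
    then have u: "u \<in> underpasses D"
      using fin by simp
    have "arc_before D u \<in> arcs D" "over_arc D u \<in> arcs D"
      unfolding arc_before_eq_arc_at over_arc_def arc_of_eq_arc_at
      using on_one_arc_crossing_D[OF u] arc_at_in_arcs by auto
    then show "snd ` set (?f u) \<subseteq> elems Q"
      using extension_in_Col unfolding Col_def colorings_def by auto
    show "acts Q z (?f u) = z" if "u \<notin> params T" "z \<in> elems Q" for z
      using extension_crossing_outside[OF u] that acts_cancel q by simp
  qed
  moreover have "longitude_part D T \<zeta> {a..b} @ longitude_part D T \<zeta> {c..d}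
      = concat (map ?f (filter (\<lambda>u. u \<in> params T) ?us))"
    unfolding filter using params_T by (simp add: longitude_part_eq longitude_list_def)
  ultimately show ?thesis
    unfolding colored_longitude_def list_map_def longitude_list_def
    by (auto simp: restrict_def fun_eq_iff)
qed

end

theorem theorem2:
  fixes Q :: "'a quandle_ops" and q :: 'a
    and D T :: diagram and \<Delta> :: "(real \<times> real) set" and I\<^sub>1 I\<^sub>2 :: "real set"
    and \<zeta>T \<zeta> :: "arc \<Rightarrow> 'a"
  assumes "quandle Q" and "finite (elems Q)" and "q \<in> elems Q"
    and "tangle_diagram \<Delta> I\<^sub>1 I\<^sub>2 T"
    and "long_knot_diagram D"
    and "part_of \<Delta> T D"
    and "\<zeta>T \<in> boundary_mono_colorings Q q \<Delta> T"
    and "\<zeta> = trivial_extension D T q \<zeta>T"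
  shows "list_map Q (longitude_part D T \<zeta> I\<^sub>1 @ longitude_part D T \<zeta> I\<^sub>2)
           \<in> colored_longitude_family Q q D
       \<or> list_map Q (longitude_part D T \<zeta> I\<^sub>2 @ longitude_part D T \<zeta> I\<^sub>1)
           \<in> colored_longitude_family Q q D"
proof -
  obtain a b c d where ab: "a < b" "c < d" "I\<^sub>1 = {a..b}" "I\<^sub>2 = {c..d}" "I\<^sub>1 \<inter> I\<^sub>2 = {}"
    and tangle: "is_diagram T" "params T = {a..b} \<union> {c..d}"
      "\<forall>t\<in>params T. curve T t \<in> frontier \<Delta> \<longleftrightarrow> t \<in> {a, b, c, d}"
      "inj_on (curve T) {a, b, c, d}"
    using assms(4) unfolding tangle_diagram_def by blast
  have swap: "{c, d, a, b} = {a, b, c, d}" by blast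
  interpret tangle: embedded_tangle Q q D T \<Delta> a b c d \<zeta>T
    using assms ab tangle by (simp add: embedded_tangle_def embedded_tangle_axioms_def)
  interpret swapped: embedded_tangle Q q D T \<Delta> c d a b \<zeta>T
    using assms ab tangle unfolding embedded_tangle_def embedded_tangle_axioms_def swap
    by (simp add: Un_commute)
  have family: "colored_longitude Q D \<zeta> \<in> colored_longitude_family Q q D"
    using tangle.extension_in_Col assms(8) unfolding colored_longitude_family_def by blast
  \<comment> \<open>The long knot runs through the disjoint intervals in one of the two orders.\<close>
  have "b < c \<or> d < a"
  proof (rule ccontr)
    assume "\<not> ?thesis"
    then have "max a c \<in> I\<^sub>1 \<inter> I\<^sub>2"
      using ab(1-4) by auto
    then show False
      using ab(5) by blast
  qed
  then show ?thesis
    using tangle.colored_longitude_extension swapped.colored_longitude_extension family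
    unfolding ab(3,4) assms(8) by auto
qed

end
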